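(* Let $A_0\in\mathbb{R}^{d\times d}$. Suppose $W_{\rm atom}\colon(\mathbb{R}^d)^{\mathcal{R}}\to(-\infty,\infty]$ is $C^2$ in a neighbourhood of $(A_0\rho)_{\rho\in\mathcal{R}}$, satisfies the symmetry condition $W_{\rm atom}(A)=W_{\rm atom}(T(A))$ for all $A\in(\mathbb{R}^d)^{\mathcal{R}}$, and $(A_0\rho)_{\rho\in\mathcal{R}}$ is a local minimizer of $W_{\rm atom}$, such that the second derivative is strictly positive in the directions of affine rank-one deformations and on the orthogonal complement of all affine deformations; that is, $D^2W_{\rm atom}((A_0\rho)_{\rho\in\mathcal{R}})[B,B]>0$ for every $B=((\xi\otimes\eta)\rho)_{\rho\in\mathcal{R}}$ with $\xi,\eta\in\mathbb{R}^d\setminus\{0\}$, and for every nonzero $B\in(\mathbb{R}^d)^{\mathcal{R}}$ that is orthogonal to $\{(F\rho)_{\rho\in\mathcal{R}}:F\in\mathbb{R}^{d\times d}\}$. Then $\lambda_{\rm atom}(A_0)>0$.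
   Context: $\mathcal{R}\subset\mathbb{Z}^d\setminus\{0\}$ is a finite set with $\operatorname{span}_{\mathbb{Z}}\mathcal{R}=\mathbb{Z}^d$ and $\mathcal{R}=-\mathcal{R}$. $T(A)_\rho=-A_{-\rho}$. $(\mathbb{R}^d)^{\mathcal{R}}$ carries the Euclidean inner product $A:B=\sum_{j,\rho}A_{j\rho}B_{j\rho}$. Atomistic stability constant: $\lambda_{\rm atom}(A_0)=\lambda_{\rm atom}(K)$ with $K=D^2W_{\rm atom}((A_0\rho)_{\rho\in\mathcal{R}})$, where: $D_{\mathcal{R},\varepsilon}y(x)=\big(\frac{y(x+\varepsilon\rho)-y(x)}{\varepsilon}\big)_{\rho\in\mathcal{R}}$; $R_0=\max\{\max_{\rho\in\mathcal{R}}|\rho|,\sqrt d/4\}$; for an open, bounded, nonempty $\Omega\subset\mathbb{R}^d$, $\operatorname{sint}_\varepsilon\Omega=\{x\in\Omega\cap\varepsilon\mathbb{Z}^d:\operatorname{dist}(x,\partial\Omega)>\varepsilon R_0\}$ and $\mathcal{A}_\varepsilon(\Omega,0)$ is the set of $y\colon\Omega\cap\varepsilon\mathbb{Z}^d\to\mathbb{R}^d$ with $y(x)=0$ whenever $\operatorname{dist}(x,\partial\Omega)\le2\varepsilon R_0$; and $$\lambda_{\rm atom}(K)=\inf_{\varepsilon>0}\ \inf_{y\in\mathcal{A}_\varepsilon(\Omega,0),\,y\ne0}\frac{\sum_{x\in\operatorname{sint}_\varepsilon\Omega}K[D_{\mathcal{R},\varepsilon}y(x),D_{\mathcal{R},\varepsilon}y(x)]}{\sum_{x\in\operatorname{sint}_\varepsilon\Omega}|D_{\mathcal{R},\varepsilon}y(x)|^2},$$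 which does not depend on the choice of $\Omega$. *)

theory Defs
  imports "HOL-Analysis.Analysis"
begin

(* The finite set R of interaction vectors is given by an injective enumeration
   \<rho> :: 'r::finite => int^'d, R = range \<rho>.  Then (R^d)^R is the Euclidean space
   (real^'d)^'r, whose library inner product is A : B = sum_{j,\<rho>} A_{j\<rho>} B_{j\<rho>}. *)

definition real_vec :: "int^'d \<Rightarrow> real^'d" where
  "real_vec z = (\<chi> j. real_of_int (z $ j))"

abbreviation int_span :: "(int^'d) set \<Rightarrow> (int^'d) set" where
  "int_span \<equiv> module.span (*s)"

lemma module_int_vec: "module ((*s) :: int \<Rightarrow> int^'d \<Rightarrow> int^'d)"
  by unfold_locales (simp_all add: vec_eq_iff algebra_simps)

definition affine_deformation :: "('r::finite \<Rightarrow> int^'d) \<Rightarrow> real^'d^'d \<Rightarrow> (real^'d)^'r" where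
  "affine_deformation \<rho> F = (\<chi> i. F *v real_vec (\<rho> i))"

definition rank_one :: "real^'d \<Rightarrow> real^'d \<Rightarrow> real^'d^'d" where
  "rank_one \<xi> \<eta> = (\<chi> i j. \<xi> $ i * \<eta> $ j)"

(* T(A)_\<rho> = - A_{-\<rho>}; the index of -\<rho> exists when R = -R and is unique when \<rho> is injective. *)
definition T_sym :: "('r::finite \<Rightarrow> int^'d) \<Rightarrow> (real^'d)^'r \<Rightarrow> (real^'d)^'r" where
  "T_sym \<rho> A = (\<chi> i. - (A $ (inv \<rho> (- \<rho> i))))"

definition C2_on :: "('a::real_normed_vector \<Rightarrow> real) \<Rightarrow> 'a set \<Rightarrow> bool" where
  "C2_on f U \<longleftrightarrow>
     (\<exists>(f' :: 'a \<Rightarrow> 'a \<Rightarrow>\<^sub>L real) (f'' :: 'a \<Rightarrow> 'a \<Rightarrow>\<^sub>L 'a \<Rightarrow>\<^sub>L real).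
        (\<forall>x\<in>U. (f has_derivative blinfun_apply (f' x)) (at x)) \<and>
        (\<forall>x\<in>U. (f' has_derivative blinfun_apply (f'' x)) (at x)) \<and>
        continuous_on U f'')"

definition C2_near :: "('a::real_normed_vector \<Rightarrow> ereal) \<Rightarrow> 'a \<Rightarrow> bool" where
  "C2_near W a \<longleftrightarrow>
     (\<exists>U. open U \<and> a \<in> U \<and> (\<forall>x\<in>U. \<bar>W x\<bar> \<noteq> \<infinity>) \<and> C2_on (\<lambda>x. real_of_ereal (W x)) U)"

definition D2 :: "('a::real_normed_vector \<Rightarrow> real) \<Rightarrow> 'a \<Rightarrow> 'a \<Rightarrow> 'a \<Rightarrow> real" where
  "D2 f a u v = frechet_derivative (\<lambda>x. frechet_derivative f (at x) v) (at a) u"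

lemma D2_eq:
  assumes "open U" "a \<in> U"
    and f': "\<And>x. x \<in> U \<Longrightarrow> (f has_derivative blinfun_apply (f' x)) (at x)"
    and f'': "(f' has_derivative blinfun_apply f'') (at a)"
  shows "D2 f a u v = blinfun_apply (blinfun_apply f'' u) v"
proof -
  have "((\<lambda>x. blinfun_apply (f' x) v) has_derivative (\<lambda>h. blinfun_apply (blinfun_apply f'' h) v)) (at a)"
    by (rule bounded_linear.has_derivative[OF blinfun.bounded_linear_left f''])
  moreover have "blinfun_apply (f' x) v = frechet_derivative f (at x) v" if "x \<in> U" for x
    using frechet_derivative_at[OF f'[OF that]] by simp
  ultimately have "((\<lambda>x. frechet_derivative f (at x) v) has_derivative
      (\<lambda>h. blinfun_apply (blinfun_apply f'' h) v)) (at a)"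
    by (rule has_derivative_transform_within_open[OF _ assms(1,2)])
  from frechet_derivative_at[OF this] show ?thesis
    unfolding D2_def by (rule fun_cong[OF sym])
qed

definition lattice :: "real \<Rightarrow> (real^'d) set" where
  "lattice \<epsilon> = range (\<lambda>z. \<epsilon> *\<^sub>R real_vec z)"

definition discrete_gradient ::
  "('r::finite \<Rightarrow> int^'d) \<Rightarrow> real \<Rightarrow> (real^'d \<Rightarrow> real^'d) \<Rightarrow> real^'d \<Rightarrow> (real^'d)^'r" where
  "discrete_gradient \<rho> \<epsilon> y x = (\<chi> i. (y (x + \<epsilon> *\<^sub>R real_vec (\<rho> i)) - y x) /\<^sub>R \<epsilon>)"

definition R0 :: "('r::finite \<Rightarrow> int^'d) \<Rightarrow> real" where
  "R0 \<rho> = max (MAX i. norm (real_vec (\<rho> i))) (sqrt (real CARD('d)) / 4)"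

definition sint ::
  "('r::finite \<Rightarrow> int^'d) \<Rightarrow> real \<Rightarrow> (real^'d) set \<Rightarrow> (real^'d) set" where
  "sint \<rho> \<epsilon> \<Omega> = {x \<in> \<Omega> \<inter> lattice \<epsilon>. infdist x (frontier \<Omega>) > \<epsilon> * R0 \<rho>}"

(* Functions on \<Omega> \<inter> \<epsilon> Z^d are represented by their extension by zero.  The values outside are
   never used by discrete_gradient at points of sint. *)
definition admissible0 ::
  "('r::finite \<Rightarrow> int^'d) \<Rightarrow> real \<Rightarrow> (real^'d) set \<Rightarrow> (real^'d \<Rightarrow> real^'d) set" where
  "admissible0 \<rho> \<epsilon> \<Omega> =
     {y. (\<forall>x. x \<notin> \<Omega> \<inter> lattice \<epsilon> \<longrightarrow> y x = 0) \<and>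
         (\<forall>x \<in> \<Omega> \<inter> lattice \<epsilon>. infdist x (frontier \<Omega>) \<le> 2 * \<epsilon> * R0 \<rho> \<longrightarrow> y x = 0)}"

(* ereal-valued, so that the infimum over an empty set of y (which occurs for large \<epsilon>) is \<infinity>. *)
definition lambda_atom_form ::
  "('r::finite \<Rightarrow> int^'d) \<Rightarrow> (real^'d) set \<Rightarrow> ((real^'d)^'r \<Rightarrow> (real^'d)^'r \<Rightarrow> real) \<Rightarrow> ereal" where
  "lambda_atom_form \<rho> \<Omega> K =
     (INF \<epsilon>\<in>{0<..}. INF y\<in>admissible0 \<rho> \<epsilon> \<Omega> - {\<lambda>_. 0}.
        ereal ((\<Sum>x\<in>sint \<rho> \<epsilon> \<Omega>. K (discrete_gradient \<rho> \<epsilon> y x) (discrete_gradient \<rho> \<epsilon> y x)) /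
               (\<Sum>x\<in>sint \<rho> \<epsilon> \<Omega>. (norm (discrete_gradient \<rho> \<epsilon> y x))\<^sup>2)))"

definition D2W ::
  "('r::finite \<Rightarrow> int^'d) \<Rightarrow> ((real^'d)^'r \<Rightarrow> ereal) \<Rightarrow> real^'d^'d \<Rightarrow> (real^'d)^'r \<Rightarrow> (real^'d)^'r \<Rightarrow> real" where
  "D2W \<rho> W A0 = D2 (\<lambda>A. real_of_ereal (W A)) (affine_deformation \<rho> A0)"

definition lambda_atom ::
  "('r::finite \<Rightarrow> int^'d) \<Rightarrow> (real^'d) set \<Rightarrow> ((real^'d)^'r \<Rightarrow> ereal) \<Rightarrow> real^'d^'d \<Rightarrow> ereal" where
  "lambda_atom \<rho> \<Omega> W A0 = lambda_atom_form \<rho> \<Omega> (D2W \<rho> W A0)"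

end

theory Submission
  imports Defs "HOL-Probability.Sinc_Integral"
begin

text \<open>
  Write \<open>K\<close> for the second derivative. It is positive semidefinite because the affine deformation
  is a local minimizer, and it is invariant under \<open>T\<close>, so the even (\<open>T = -1\<close>) and odd (\<open>T = 1\<close>)
  parts of \<open>(\<real>\<^sup>d)\<^sup>R\<close> are \<open>K\<close>-orthogonal. In Fourier space the discrete gradient multiplies
  \<open>\<xi>\<close> by \<open>exp (i k \<bullet> \<rho>) - 1\<close>, whose real part \<open>cos (k \<bullet> \<rho>) - 1\<close> is even, hence orthogonal to all
  affine deformations, and whose imaginary part \<open>sin (k \<bullet> \<rho>)\<close> is odd. The even part makes the symbol
  of \<open>K\<close> positive for \<open>k\<close> outside the dual lattice; as \<open>k \<rightarrow> 0\<close> the even part is of second order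
  in \<open>k\<close> and the odd part is asymptotically the rank-one deformation \<open>\<xi> \<otimes> k\<close>. By compactness the
  symbol of \<open>K\<close> dominates that of \<open>|D y|\<^sup>2\<close> uniformly, and Parseval gives a bound independent of
  \<open>y\<close>, \<open>\<epsilon>\<close> and \<open>\<Omega>\<close>.
\<close>

section \<open>Discrete orthogonality and Parseval's identity\<close>

text \<open>The sum is the real part of a geometric series in the root of unity
  \<open>\<omega>\<close> with \<open>\<omega> ^ N = 1\<close>. The bound on \<open>q\<close> makes
  \<open>\<omega>\<close> different from \<open>1\<close> unless \<open>q = 0\<close>.\<close>

lemma sum_cos_roots_of_unity:
  fixes q :: int and N :: nat
  assumes "\<bar>q\<bar> < int N"
  shows "(\<Sum>m<N. cos (2 * pi * real m / real N * real_of_int q)) = (if q = 0 then real N else 0)"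
proof (cases "q = 0")
  case False
  have N: "N > 0" using assms by simp
  define \<omega> where "\<omega> = cis (2 * pi * real_of_int q / real N)"
  have "real N * (2 * pi * real_of_int q / real N) = 2 * pi * real_of_int q"
    using N by simp
  then have "\<omega> ^ N = cis (2 * pi * real_of_int q)"
    by (simp only: \<omega>_def Complex.DeMoivre)
  also have "\<dots> = 1" by (rule cis_multiple_2pi) simp
  finally have 1: "\<omega> ^ N = 1" .
  have "\<omega> \<noteq> 1"
  proof
    assume "\<omega> = 1"
    then have "cos (2 * pi * real_of_int q / real N) = 1"
      by (simp add: \<omega>_def complex_eq_iff)
    then obtain n where "2 * pi * real_of_int q / real N = real_of_int n * 2 * pi"
      using cos_one_2pi_int by blast
    then have "real_of_int q = real_of_int (n * int N)" using N by (simp add: field_simps)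
    then have "q = n * int N" by linarith
    with assms False show False
      using zdvd_not_zless[of "\<bar>q\<bar>" "int N"] by auto
  qed
  then have "(\<Sum>m<N. \<omega> ^ m) = 0" using 1 by (simp add: geometric_sum)
  then have "Re (\<Sum>m<N. \<omega> ^ m) = 0" by simp
  moreover have "Re (\<omega> ^ m) = cos (2 * pi * real m / real N * real_of_int q)" for m
    by (simp add: \<omega>_def Complex.DeMoivre mult_ac)
  ultimately show ?thesis using False by simp
qed simp

text \<open>Taking the entries of \<open>z\<close> as coefficients at distinct exponents turns each
  nonzero \<open>z\<close> into a nonzero polynomial. An integer \<open>M\<close> avoiding the
  finitely many roots of these polynomials gives the covector of powers of \<open>M\<close>.\<close>

lemma exists_integer_covector:
  fixes F :: "(int^'d) set"
  assumes "finite F" "0 \<notin> F"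
  obtains w :: "int^'d" where "\<And>z. z \<in> F \<Longrightarrow> (\<Sum>j\<in>UNIV. w $ j * z $ j) \<noteq> 0"
proof -
  obtain idx :: "'d \<Rightarrow> nat" where idx: "inj idx"
    using finite_imp_inj_to_nat_seg[of "UNIV :: 'd set"] by auto
  define p :: "int^'d \<Rightarrow> int poly" where "p z = (\<Sum>j\<in>UNIV. monom (z $ j) (idx j))" for z
  have "p z \<noteq> 0" if "z \<noteq> 0" for z
  proof -
    from that obtain j where j: "z $ j \<noteq> 0" by (auto simp: vec_eq_iff)
    have "coeff (p z) (idx j) = (\<Sum>i\<in>UNIV. if i = j then z $ i else 0)"
      unfolding p_def coeff_sum by (rule sum.cong) (auto simp: inj_eq[OF idx])
    then show ?thesis using j by auto
  qed
  then have "p z \<noteq> 0" if "z \<in> F" for z using that assms(2) by metis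
  then have "finite (\<Union>z\<in>F. {M. poly (p z) M = 0})"
    using assms(1) by (intro finite_UN_I poly_roots_finite)
  then obtain M where M: "M \<notin> (\<Union>z\<in>F. {M. poly (p z) M = 0})"
    using ex_new_if_finite infinite_UNIV_int by blast
  show thesis
  proof (rule that[of "\<chi> j. M ^ idx j"])
    fix z assume "z \<in> F"
    then have "poly (p z) M \<noteq> 0" using M by blast
    then show "(\<Sum>j\<in>UNIV. (\<chi> j. M ^ idx j) $ j * z $ j) \<noteq> 0"
      by (simp add: p_def poly_sum poly_monom mult_ac)
  qed
qed

lemma inner_real_vec: "real_vec w \<bullet> real_vec z = real_of_int (\<Sum>j\<in>UNIV. w $ j * z $ j)"
  by (simp add: inner_vec_def real_vec_def)

lemma real_vec_simps [simp]:
  "real_vec 0 = 0"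
  "real_vec (a + b) = real_vec a + real_vec b"
  "real_vec (a - b) = real_vec a - real_vec b"
  "real_vec (- a) = - real_vec a"
  "real_vec (n *s a) = real_of_int n *\<^sub>R real_vec a"
  "real_vec (axis j 1) = axis j 1"
  "real_vec a = real_vec b \<longleftrightarrow> a = b"
  by (auto simp: real_vec_def vec_eq_iff axis_def)

text \<open>
  An integer covector \<open>w\<close> that is injective on \<open>Z\<close> and a large modulus \<open>N\<close> reduce Parseval's
  identity on \<open>\<int>\<^sup>d\<close> to a one-dimensional discrete Fourier transform, with frequencies
  \<open>2 \<pi> m w / N\<close>.
\<close>
lemma discrete_Parseval:
  fixes Z :: "(int^'d) set"
  assumes Z: "finite Z"
  obtains ks :: "nat \<Rightarrow> real^'d" and N :: nat where "N > 0"
    "\<And>(K :: 'v::real_normed_vector \<Rightarrow> 'v \<Rightarrow> real) g. bounded_bilinear K \<Longrightarrow>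
      (\<Sum>m<N. K (\<Sum>z\<in>Z. cos (ks m \<bullet> real_vec z) *\<^sub>R g z) (\<Sum>z\<in>Z. cos (ks m \<bullet> real_vec z) *\<^sub>R g z)
           + K (\<Sum>z\<in>Z. sin (ks m \<bullet> real_vec z) *\<^sub>R g z) (\<Sum>z\<in>Z. sin (ks m \<bullet> real_vec z) *\<^sub>R g z))
      = real N * (\<Sum>z\<in>Z. K (g z) (g z))"
proof -
  define F where "F = (\<lambda>(a, b). a - b) ` (Z \<times> Z)"
  have F: "finite F" unfolding F_def using Z by auto
  obtain w :: "int^'d" where w: "\<And>z. z \<in> F - {0} \<Longrightarrow> (\<Sum>j\<in>UNIV. w $ j * z $ j) \<noteq> 0"
    using exists_integer_covector[of "F - {0}"] F by auto
  define q where "q z = (\<Sum>j\<in>UNIV. w $ j * z $ j)" for z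
  \<comment> \<open>Larger than every \<open>\<bar>q z\<bar>\<close> on the difference set, so that
    distinct points of \<open>Z\<close> have values of \<open>q\<close> that differ modulo
    \<open>N\<close>.\<close>
  define N where "N = Suc (nat (\<Sum>z\<in>F. \<bar>q z\<bar>))"
  have qN: "\<bar>q z\<bar> < int N" if "z \<in> F" for z
    using member_le_sum[OF that, of "\<lambda>z. \<bar>q z\<bar>"] F unfolding N_def by force
  define ks where "ks m = (2 * pi * real m / real N) *\<^sub>R real_vec w" for m
  have ks: "ks m \<bullet> real_vec z = 2 * pi * real m / real N * real_of_int (q z)" for m z
    by (simp add: ks_def inner_real_vec q_def)
  have orth: "(\<Sum>m<N. cos (ks m \<bullet> real_vec (a - b))) = (if a = b then real N else 0)"
    if "a \<in> Z" "b \<in> Z" for a b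
  proof -
    have ab: "a - b \<in> F" unfolding F_def using that by force
    have "q (a - b) = 0 \<longleftrightarrow> a = b"
      using w[of "a - b"] ab unfolding q_def by (cases "a = b") auto
    then show ?thesis
      unfolding ks using sum_cos_roots_of_unity[OF qN[OF ab]] by simp
  qed
  show thesis
  proof (rule that[of N ks])
    show "N > 0" by (simp add: N_def)
    fix K :: "'v \<Rightarrow> 'v \<Rightarrow> real" and g :: "int^'d \<Rightarrow> 'v"
    assume "bounded_bilinear K"
    then interpret K: bounded_bilinear K .
    have "(\<Sum>m<N. K (\<Sum>z\<in>Z. cos (ks m \<bullet> real_vec z) *\<^sub>R g z) (\<Sum>z\<in>Z. cos (ks m \<bullet> real_vec z) *\<^sub>R g z)
           + K (\<Sum>z\<in>Z. sin (ks m \<bullet> real_vec z) *\<^sub>R g z) (\<Sum>z\<in>Z. sin (ks m \<bullet> real_vec z) *\<^sub>R g z))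
       = (\<Sum>m<N. \<Sum>a\<in>Z. \<Sum>b\<in>Z. cos (ks m \<bullet> real_vec (a - b)) * K (g b) (g a))"
      by (rule sum.cong[OF refl])
        (simp add: K.sum_left K.sum_right K.scaleR_left K.scaleR_right cos_diff
          sum.distrib[symmetric] sum_distrib_left algebra_simps)
    also have "\<dots> = (\<Sum>a\<in>Z. \<Sum>m<N. \<Sum>b\<in>Z. cos (ks m \<bullet> real_vec (a - b)) * K (g b) (g a))"
      by (rule sum.swap)
    also have "\<dots> = (\<Sum>a\<in>Z. \<Sum>b\<in>Z. \<Sum>m<N. cos (ks m \<bullet> real_vec (a - b)) * K (g b) (g a))"
      by (intro sum.cong[OF refl]) (rule sum.swap)
    also have "\<dots> = (\<Sum>a\<in>Z. \<Sum>b\<in>Z. (if a = b then real N else 0) * K (g b) (g a))"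
      by (intro sum.cong[OF refl]) (simp only: sum_distrib_right[symmetric] orth)
    also have "\<dots> = (\<Sum>a\<in>Z. \<Sum>b\<in>Z. if a = b then real N * K (g b) (g a) else 0)"
      by (intro sum.cong[OF refl]) simp
    also have "\<dots> = real N * (\<Sum>z\<in>Z. K (g z) (g z))"
      using Z by (simp add: sum_distrib_left)
    finally show "(\<Sum>m<N. K (\<Sum>z\<in>Z. cos (ks m \<bullet> real_vec z) *\<^sub>R g z) (\<Sum>z\<in>Z. cos (ks m \<bullet> real_vec z) *\<^sub>R g z)
           + K (\<Sum>z\<in>Z. sin (ks m \<bullet> real_vec z) *\<^sub>R g z) (\<Sum>z\<in>Z. sin (ks m \<bullet> real_vec z) *\<^sub>R g z))
      = real N * (\<Sum>z\<in>Z. K (g z) (g z))" .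
  qed
qed

section \<open>The Fourier symbol of the discrete gradient and its parity\<close>

text \<open>Real part of the symbol applied to \<open>\<xi>\<close>; \<open>odd_symbol\<close> is
  the imaginary part. Keeping them apart avoids complexifying the space. Parity refers to replacing
  an interaction vector by its negative.\<close>

definition even_symbol :: "('r::finite \<Rightarrow> int^'d) \<Rightarrow> real^'d \<Rightarrow> real^'d \<Rightarrow> (real^'d)^'r" where
  "even_symbol \<rho> k \<xi> = (\<chi> i. (cos (k \<bullet> real_vec (\<rho> i)) - 1) *\<^sub>R \<xi>)"

definition odd_symbol :: "('r::finite \<Rightarrow> int^'d) \<Rightarrow> real^'d \<Rightarrow> real^'d \<Rightarrow> (real^'d)^'r" where
  "odd_symbol \<rho> k \<xi> = (\<chi> i. sin (k \<bullet> real_vec (\<rho> i)) *\<^sub>R \<xi>)"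

lemma symbol_simps:
  "even_symbol \<rho> k \<xi> $ i = (cos (k \<bullet> real_vec (\<rho> i)) - 1) *\<^sub>R \<xi>"
  "odd_symbol \<rho> k \<xi> $ i = sin (k \<bullet> real_vec (\<rho> i)) *\<^sub>R \<xi>"
  by (simp_all add: even_symbol_def odd_symbol_def)

lemma symbol_scaleR:
  "even_symbol \<rho> k (c *\<^sub>R \<xi>) = c *\<^sub>R even_symbol \<rho> k \<xi>"
  "odd_symbol \<rho> k (c *\<^sub>R \<xi>) = c *\<^sub>R odd_symbol \<rho> k \<xi>"
  by (simp_all add: vec_eq_iff symbol_simps)

lemma reindex_uminus:
  fixes \<rho> :: "'r \<Rightarrow> 'a::group_add"
  assumes "inj \<rho>" and "uminus ` range \<rho> = range \<rho>"
  shows "\<rho> (inv \<rho> (- \<rho> i)) = - \<rho> i"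
    and "inv \<rho> (- \<rho> (inv \<rho> (- \<rho> i))) = i"
proof -
  have "- \<rho> i \<in> range \<rho>" using assms(2) by blast
  then show *: "\<rho> (inv \<rho> (- \<rho> i)) = - \<rho> i" by (rule f_inv_into_f)
  show "inv \<rho> (- \<rho> (inv \<rho> (- \<rho> i))) = i"
    unfolding * minus_minus by (rule inv_f_f[OF assms(1)])
qed

lemma bounded_linear_T_sym: "bounded_linear (T_sym \<rho>)"
  by (rule linear_conv_bounded_linear[THEN iffD1]) (rule linearI, simp_all add: T_sym_def vec_eq_iff)

text \<open>Because of the minus sign in \<open>T_sym\<close>, families odd in the interaction
  vector are fixed and even ones change sign.\<close>

lemma T_sym_fixed:
  assumes "inj \<rho>" and "uminus ` range \<rho> = range \<rho>"
  shows "T_sym \<rho> (affine_deformation \<rho> F) = affine_deformation \<rho> F"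
    and "T_sym \<rho> (odd_symbol \<rho> k \<xi>) = odd_symbol \<rho> k \<xi>"
    and "T_sym \<rho> (even_symbol \<rho> k \<xi>) = - even_symbol \<rho> k \<xi>"
  by (simp_all add: vec_eq_iff T_sym_def affine_deformation_def symbol_simps
      reindex_uminus[OF assms] matrix_vector_mult_def sum_negf algebra_simps)

lemma T_sym_isometry:
  assumes "inj \<rho>" and "uminus ` range \<rho> = range \<rho>"
  shows "T_sym \<rho> A \<bullet> T_sym \<rho> B = A \<bullet> B"
  unfolding inner_vec_def[of "T_sym \<rho> A"] inner_vec_def[of A]
  by (rule sum.reindex_bij_witness[of _ "\<lambda>i. inv \<rho> (- \<rho> i)" "\<lambda>i. inv \<rho> (- \<rho> i)"])
    (simp_all add: reindex_uminus[OF assms] T_sym_def inv_f_f[OF assms(1)])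

text \<open>The two vectors belong to the eigenvalues -1 and 1 of the isometry
  \<open>T_sym \<rho>\<close>, so their inner product equals its own negative.\<close>

lemma even_symbol_orthogonal_affine:
  assumes "inj \<rho>" and "uminus ` range \<rho> = range \<rho>"
  shows "orthogonal (even_symbol \<rho> k \<xi>) (affine_deformation \<rho> F)"
  using T_sym_isometry[OF assms, of "even_symbol \<rho> k \<xi>" "affine_deformation \<rho> F"]
  by (simp add: T_sym_fixed[OF assms] orthogonal_def)

lemma rank_one_mult_vec: "rank_one \<xi> \<eta> *v v = (\<eta> \<bullet> v) *\<^sub>R \<xi>"
  by (simp add: vec_eq_iff rank_one_def matrix_vector_mult_def inner_vec_def sum_distrib_left
      sum_distrib_right mult_ac)

text \<open>If all cosines equal 1, then \<open>k\<close> pairs with every interaction vector to a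
  multiple of \<open>2 * pi\<close>. The integer vectors with this property form a submodule, hence
  are all of them. Testing on the coordinate axes gives entries of \<open>k\<close> in
  \<open>2 * pi\<close> times the integers, and the bound by \<open>pi\<close> leaves only
  0.\<close>

lemma even_symbol_nonzero:
  fixes \<rho> :: "'r::finite \<Rightarrow> int^'d"
  assumes span: "int_span (range \<rho>) = UNIV"
    and k: "\<And>j. \<bar>k $ j\<bar> \<le> pi" "k \<noteq> 0" and "\<xi> \<noteq> 0"
  shows "even_symbol \<rho> k \<xi> \<noteq> 0"
proof
  assume 0: "even_symbol \<rho> k \<xi> = 0"
  define P where "P = {z :: int^'d. \<exists>n::int. k \<bullet> real_vec z = real_of_int n * 2 * pi}"
  have "\<rho> i \<in> P" for i
  proof -
    have "cos (k \<bullet> real_vec (\<rho> i)) = 1"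
      using arg_cong[OF 0, of "\<lambda>v. v $ i"] \<open>\<xi> \<noteq> 0\<close> by (simp add: symbol_simps)
    then show ?thesis unfolding P_def cos_one_2pi_int by simp
  qed
  moreover have "module.subspace (*s) P"
  proof (rule module.subspaceI[OF module_int_vec])
    show "0 \<in> P" unfolding P_def by (auto intro: exI[of _ 0])
    fix x y assume "x \<in> P" "y \<in> P"
    then obtain m n :: int where "k \<bullet> real_vec x = real_of_int m * 2 * pi"
      "k \<bullet> real_vec y = real_of_int n * 2 * pi" unfolding P_def by blast
    then have "k \<bullet> real_vec (x + y) = real_of_int (m + n) * 2 * pi"
      by (simp add: inner_add_right algebra_simps)
    then show "x + y \<in> P" unfolding P_def by blast
  next
    fix c :: int and x assume "x \<in> P"
    then obtain m :: int where "k \<bullet> real_vec x = real_of_int m * 2 * pi" unfolding P_def by blast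
    then have "k \<bullet> real_vec (c *s x) = real_of_int (c * m) * 2 * pi" by simp
    then show "c *s x \<in> P" unfolding P_def by blast
  qed
  ultimately have "int_span (range \<rho>) \<subseteq> P"
    by (intro module.span_minimal[OF module_int_vec]) auto
  then have P: "z \<in> P" for z using span by auto
  have "k $ j = 0" for j
  proof -
    obtain n :: int where n: "k \<bullet> real_vec (axis j 1) = real_of_int n * 2 * pi"
      using P[of "axis j 1"] unfolding P_def by blast
    then have n: "k $ j = real_of_int n * 2 * pi" by (simp add: inner_axis)
    have "\<bar>real_of_int n\<bar> * 2 * pi \<le> 1 * pi" using k(1)[of j] unfolding n by (simp add: abs_mult)
    then have "\<bar>real_of_int n\<bar> * 2 \<le> 1" using pi_gt_zero by (simp add: mult_le_cancel_right del: mult_1)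
    then have "n = 0" by linarith
    then show ?thesis using n by simp
  qed
  then show False using \<open>k \<noteq> 0\<close> by (simp add: vec_eq_iff)
qed

section \<open>Uniform coercivity of the symbol of \<open>K\<close>\<close>

text \<open>After division by the squared norms of \<open>k\<close> and \<open>\<xi>\<close>, the
  right-hand side is a continuous positive function on a compact set, including the limit directions
  at \<open>k = 0\<close>; \<open>h\<close> is a lower bound for it.\<close>

lemma symbol_coercive_box:
  fixes \<rho> :: "'r::finite \<Rightarrow> int^'d" and K :: "(real^'d)^'r \<Rightarrow> (real^'d)^'r \<Rightarrow> real"
  assumes inj: "inj \<rho>" and sym: "uminus ` range \<rho> = range \<rho>"
    and span: "int_span (range \<rho>) = UNIV"
    and K: "bounded_bilinear K" and psd: "\<And>B. K B B \<ge> 0"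
    and rank1: "\<And>\<xi> \<eta>. \<xi> \<noteq> 0 \<Longrightarrow> \<eta> \<noteq> 0 \<Longrightarrow>
           K (affine_deformation \<rho> (rank_one \<xi> \<eta>)) (affine_deformation \<rho> (rank_one \<xi> \<eta>)) > 0"
    and orth: "\<And>B. B \<noteq> 0 \<Longrightarrow> (\<And>F. orthogonal B (affine_deformation \<rho> F)) \<Longrightarrow> K B B > 0"
  obtains h where "h > 0"
    "\<And>k \<xi>. (\<And>j. \<bar>k $ j\<bar> \<le> pi) \<Longrightarrow>
       h * (norm k)\<^sup>2 * (norm \<xi>)\<^sup>2 \<le>
         K (even_symbol \<rho> k \<xi>) (even_symbol \<rho> k \<xi>) + K (odd_symbol \<rho> k \<xi>) (odd_symbol \<rho> k \<xi>)"
proof -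
  interpret K: bounded_bilinear K by fact
  define a where "a i \<eta> = \<eta> \<bullet> real_vec (\<rho> i)" for i and \<eta> :: "real^'d"
  txt \<open>
    In polar form \<open>k = t \<eta>\<close> the maps \<open>e\<close> and \<open>f\<close> are the even and odd symbols divided by \<open>t\<close>,
    extended continuously to \<open>t = 0\<close>.
  \<close>
  define e :: "real \<times> (real^'d) \<times> (real^'d) \<Rightarrow> (real^'d)^'r" where
    "e = (\<lambda>p. \<chi> i. (- sin (fst p * a i (fst (snd p)) / 2) * a i (fst (snd p))
             * sinc (fst p * a i (fst (snd p)) / 2)) *\<^sub>R snd (snd p))"
  define f :: "real \<times> (real^'d) \<times> (real^'d) \<Rightarrow> (real^'d)^'r" where
    "f = (\<lambda>p. \<chi> i. (a i (fst (snd p)) * sinc (fst p * a i (fst (snd p)))) *\<^sub>R snd (snd p))"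
  define H where "H p = K (e p) (e p) + K (f p) (f p)" for p
  \<comment> \<open>Half-angle formula: one of the two sine factors in \<open>cos x - 1\<close> is
    written through \<open>sinc\<close>, which absorbs the division by \<open>t\<close>.\<close>
  have te: "t *\<^sub>R e (t, \<eta>, \<xi>) = even_symbol \<rho> (t *\<^sub>R \<eta>) \<xi>" for t \<eta> \<xi>
  proof -
    have "cos x - 1 = - 2 * (sin (x/2))\<^sup>2" for x :: real
      using cos_double_sin[of "x/2"] by simp
    then show ?thesis
      by (auto simp: vec_eq_iff e_def symbol_simps a_def power2_eq_square)
  qed
  have tf: "t *\<^sub>R f (t, \<eta>, \<xi>) = odd_symbol \<rho> (t *\<^sub>R \<eta>) \<xi>" for t \<eta> \<xi>
    by (auto simp: vec_eq_iff f_def symbol_simps a_def)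
  have tH: "t\<^sup>2 * H (t, \<eta>, \<xi>) = K (even_symbol \<rho> (t *\<^sub>R \<eta>) \<xi>) (even_symbol \<rho> (t *\<^sub>R \<eta>) \<xi>)
      + K (odd_symbol \<rho> (t *\<^sub>R \<eta>) \<xi>) (odd_symbol \<rho> (t *\<^sub>R \<eta>) \<xi>)" for t \<eta> \<xi>
    unfolding te[symmetric] tf[symmetric]
    by (simp add: H_def K.scaleR_left K.scaleR_right power2_eq_square algebra_simps)
  \<comment> \<open>The radius comes from bounding the Euclidean norm on the box by the sum of the
    absolute values of the entries. Direction and amplitude range over unit spheres.\<close>
  define S :: "(real \<times> (real^'d) \<times> (real^'d)) set" where
    "S = ({0..real CARD('d) * pi} \<times> sphere 0 1 \<times> sphere 0 1)
        \<inter> (\<Inter>j. {p. \<bar>fst p * fst (snd p) $ j\<bar> \<le> pi})"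
  have "compact S"
    unfolding S_def
    by (intro compact_Int_closed compact_Times closed_INT ballI closed_Collect_le continuous_intros) auto
  moreover have "continuous_on S H"
  proof -
    have "continuous_on S e" unfolding e_def a_def by (intro continuous_intros) auto
    moreover have "continuous_on S f" unfolding f_def a_def by (intro continuous_intros)
    ultimately show ?thesis unfolding H_def by (intro continuous_intros K.continuous_on)
  qed
  moreover have pos: "H p > 0" if p: "p \<in> S" for p
  proof -
    obtain t \<eta> \<xi> where [simp]: "p = (t, \<eta>, \<xi>)" by (cases p)
    have *: "t \<ge> 0" "norm \<eta> = 1" "norm \<xi> = 1" "\<And>j. \<bar>(t *\<^sub>R \<eta>) $ j\<bar> \<le> pi"
      using p by (auto simp: S_def)
    then have nz: "\<eta> \<noteq> 0" "\<xi> \<noteq> 0" by auto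
    show ?thesis
    proof (cases "t = 0")
      case True
      \<comment> \<open>At \<open>t = 0\<close> strict positivity comes from the odd part, through
        the rank-one hypothesis; for \<open>t > 0\<close> it comes from the even part, through
        orthogonality to affine deformations.\<close>
      then have "f p = affine_deformation \<rho> (rank_one \<xi> \<eta>)"
        by (simp add: f_def vec_eq_iff affine_deformation_def rank_one_mult_vec a_def)
      then show ?thesis
        unfolding H_def using rank1[OF nz(2,1)] psd[of "e p"] by simp
    next
      case False
      have "K (even_symbol \<rho> (t *\<^sub>R \<eta>) \<xi>) (even_symbol \<rho> (t *\<^sub>R \<eta>) \<xi>) > 0"
        by (intro orth even_symbol_orthogonal_affine inj sym even_symbol_nonzero span *)
           (use False nz in auto)
      then have "t\<^sup>2 * H p > 0"
        using tH[of t \<eta> \<xi>] psd[of "odd_symbol \<rho> (t *\<^sub>R \<eta>) \<xi>"] by simp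
      then show ?thesis using False by (simp add: zero_less_mult_iff)
    qed
  qed
  ultimately obtain h where h: "h > 0" "\<And>p. p \<in> S \<Longrightarrow> h \<le> H p"
  proof (cases "S = {}")
    case False
    then obtain p where "p \<in> S" "\<forall>q\<in>S. H p \<le> H q"
      using continuous_attains_inf[OF \<open>compact S\<close> False \<open>continuous_on S H\<close>] by blast
    then show thesis using pos that by blast
  \<comment> \<open>If \<open>S\<close> were empty, any positive constant would do.\<close>
  qed (auto intro: that[of 1])
  show thesis
  proof (rule that[OF h(1)])
    fix k \<xi> :: "real^'d" assume box: "\<And>j. \<bar>k $ j\<bar> \<le> pi"
    show "h * (norm k)\<^sup>2 * (norm \<xi>)\<^sup>2 \<le>
         K (even_symbol \<rho> k \<xi>) (even_symbol \<rho> k \<xi>) + K (odd_symbol \<rho> k \<xi>) (odd_symbol \<rho> k \<xi>)"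
    proof (cases "k = 0 \<or> \<xi> = 0")
      case True then show ?thesis using psd by (auto intro: add_nonneg_nonneg)
    next
      case False
      define \<eta> where "\<eta> = k /\<^sub>R norm k"
      define \<zeta> where "\<zeta> = \<xi> /\<^sub>R norm \<xi>"
      have k: "norm k *\<^sub>R \<eta> = k" and \<xi>: "\<xi> = norm \<xi> *\<^sub>R \<zeta>"
        using False by (auto simp: \<eta>_def \<zeta>_def)
      have "norm k \<le> real CARD('d) * pi"
        using norm_le_l1_cart[of k] sum_bounded_above[of UNIV "\<lambda>j. \<bar>k $ j\<bar>" pi] box by simp
      moreover have "\<bar>norm k * \<eta> $ j\<bar> \<le> pi" for j
        using box[of j] arg_cong[OF k, of "\<lambda>v. v $ j"] by simp
      ultimately have "(norm k, \<eta>, \<zeta>) \<in> S"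
        using False by (auto simp: S_def \<eta>_def \<zeta>_def)
      then have "h \<le> H (norm k, \<eta>, \<zeta>)" by (rule h(2))
      then have "((norm k)\<^sup>2 * (norm \<xi>)\<^sup>2) * h \<le> ((norm k)\<^sup>2 * (norm \<xi>)\<^sup>2) * H (norm k, \<eta>, \<zeta>)"
        by (rule mult_left_mono) simp
      also have "\<dots> = (norm \<xi>)\<^sup>2 * ((norm k)\<^sup>2 * H (norm k, \<eta>, \<zeta>))" by simp
      also have "\<dots> = K (even_symbol \<rho> k \<xi>) (even_symbol \<rho> k \<xi>)
            + K (odd_symbol \<rho> k \<xi>) (odd_symbol \<rho> k \<xi>)"
        unfolding tH k symbol_scaleR[of _ _ "norm \<xi>" \<zeta>, folded \<xi>]
        by (simp add: K.scaleR_left K.scaleR_right power2_eq_square algebra_simps)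
      finally show ?thesis by (simp add: mult_ac)
    qed
  qed
qed

text \<open>Each component contributes the squared modulus of \<open>exp (i x) - 1\<close>, which is
  \<open>4 * (sin (x/2))\<^sup>2\<close> and so at most \<open>x\<^sup>2\<close>; Cauchy-Schwarz
  bounds \<open>x\<close>, the inner product of \<open>k\<close> with the interaction
  vector.\<close>

lemma norm_symbol_le:
  fixes \<rho> :: "'r::finite \<Rightarrow> int^'d"
  shows "(norm (even_symbol \<rho> k \<xi>))\<^sup>2 + (norm (odd_symbol \<rho> k \<xi>))\<^sup>2
    \<le> (\<Sum>i\<in>UNIV. (norm (real_vec (\<rho> i)))\<^sup>2) * ((norm k)\<^sup>2 * (norm \<xi>)\<^sup>2)"
proof -
  have trig: "(cos x - 1)\<^sup>2 + (sin x)\<^sup>2 \<le> x\<^sup>2" for x :: real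
  proof -
    have c: "cos x = 1 - 2 * (sin (x/2))\<^sup>2" using cos_double_sin[of "x/2"] by simp
    have "(cos x - 1)\<^sup>2 + (sin x)\<^sup>2 = 2 - 2 * cos x"
      using sin_cos_squared_add[of x] by (simp add: power2_eq_square algebra_simps)
    also have "\<dots> = 4 * \<bar>sin (x/2)\<bar>\<^sup>2" by (simp add: c)
    also have "\<dots> \<le> 4 * \<bar>x/2\<bar>\<^sup>2"
      by (intro mult_left_mono power_mono abs_sin_x_le_abs_x) auto
    finally show ?thesis by (simp add: power_divide)
  qed
  have "(norm (even_symbol \<rho> k \<xi>))\<^sup>2 + (norm (odd_symbol \<rho> k \<xi>))\<^sup>2
      = (\<Sum>i\<in>UNIV. ((cos (k \<bullet> real_vec (\<rho> i)) - 1)\<^sup>2 + (sin (k \<bullet> real_vec (\<rho> i)))\<^sup>2) * (norm \<xi>)\<^sup>2)"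
    unfolding power2_norm_eq_inner
    by (subst (1 2) inner_vec_def)
       (simp add: symbol_simps sum.distrib[symmetric] power2_eq_square distrib_left mult_ac)
  also have "\<dots> \<le> (\<Sum>i\<in>UNIV. ((norm (real_vec (\<rho> i)))\<^sup>2 * (norm k)\<^sup>2) * (norm \<xi>)\<^sup>2)"
  proof (intro sum_mono mult_right_mono)
    fix i
    have "(k \<bullet> real_vec (\<rho> i))\<^sup>2 \<le> (norm k * norm (real_vec (\<rho> i)))\<^sup>2"
      using power_mono[OF Cauchy_Schwarz_ineq2[of k "real_vec (\<rho> i)"], of 2] by simp
    then show "(cos (k \<bullet> real_vec (\<rho> i)) - 1)\<^sup>2 + (sin (k \<bullet> real_vec (\<rho> i)))\<^sup>2
        \<le> (norm (real_vec (\<rho> i)))\<^sup>2 * (norm k)\<^sup>2"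
      using trig[of "k \<bullet> real_vec (\<rho> i)"] by (simp add: power_mult_distrib mult.commute)
  qed simp
  finally show ?thesis by (simp add: sum_distrib_right mult.assoc)
qed

text \<open>On integer vectors, frequencies matter only modulo \<open>2 * pi\<close> times integer
  vectors. Rounding each entry of \<open>k / (2 * pi)\<close> to a nearest integer leaves a
  remainder of at most 1/2.\<close>

lemma exists_box_representative:
  fixes k :: "real^'d"
  obtains k' where "\<And>j. \<bar>k' $ j\<bar> \<le> pi"
    "\<And>z. cos (k' \<bullet> real_vec z) = cos (k \<bullet> real_vec z)"
    "\<And>z. sin (k' \<bullet> real_vec z) = sin (k \<bullet> real_vec z)"
proof -
  define n where "n j = round (k $ j / (2 * pi))" for j
  define k' where "k' = k - (2 * pi) *\<^sub>R real_vec (\<chi> j. n j)"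
  show thesis
  proof (rule that[of k'])
    fix j
    have "\<bar>real_of_int (n j) - k $ j / (2 * pi)\<bar> * (2 * pi) \<le> 1 / 2 * (2 * pi)"
      unfolding n_def by (intro mult_right_mono of_int_round_abs_le) simp
    also have "\<bar>real_of_int (n j) - k $ j / (2 * pi)\<bar> * (2 * pi)
        = \<bar>(real_of_int (n j) - k $ j / (2 * pi)) * (2 * pi)\<bar>"
      by (simp add: abs_mult)
    also have "(real_of_int (n j) - k $ j / (2 * pi)) * (2 * pi) = - (k' $ j)"
      by (simp add: k'_def real_vec_def field_simps)
    finally show "\<bar>k' $ j\<bar> \<le> pi" by simp
  next
    fix z
    have *: "k' \<bullet> real_vec z = k \<bullet> real_vec z - 2 * pi * real_of_int (\<Sum>j\<in>UNIV. n j * z $ j)"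
      by (simp add: k'_def inner_diff_left inner_real_vec)
    show "cos (k' \<bullet> real_vec z) = cos (k \<bullet> real_vec z)"
      "sin (k' \<bullet> real_vec z) = sin (k \<bullet> real_vec z)"
      unfolding * cos_diff sin_diff by (simp_all del: of_int_sum of_int_mult)
  qed
qed

text \<open>Both sides are periodic in \<open>k\<close>, so \<open>k\<close> may be moved into the
  box. There the lower bound for \<open>K\<close> and the upper bound for the norms have the same
  order in \<open>k\<close> and \<open>\<xi>\<close>.\<close>

lemma symbol_coercive:
  fixes \<rho> :: "'r::finite \<Rightarrow> int^'d" and K :: "(real^'d)^'r \<Rightarrow> (real^'d)^'r \<Rightarrow> real"
  assumes "inj \<rho>" "uminus ` range \<rho> = range \<rho>" "int_span (range \<rho>) = UNIV"
    and "bounded_bilinear K" "\<And>B. K B B \<ge> 0"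
    and "\<And>\<xi> \<eta>. \<xi> \<noteq> 0 \<Longrightarrow> \<eta> \<noteq> 0 \<Longrightarrow>
           K (affine_deformation \<rho> (rank_one \<xi> \<eta>)) (affine_deformation \<rho> (rank_one \<xi> \<eta>)) > 0"
    and "\<And>B. B \<noteq> 0 \<Longrightarrow> (\<And>F. orthogonal B (affine_deformation \<rho> F)) \<Longrightarrow> K B B > 0"
  obtains c where "c > 0"
    "\<And>k \<xi>. c * ((norm (even_symbol \<rho> k \<xi>))\<^sup>2 + (norm (odd_symbol \<rho> k \<xi>))\<^sup>2) \<le>
         K (even_symbol \<rho> k \<xi>) (even_symbol \<rho> k \<xi>) + K (odd_symbol \<rho> k \<xi>) (odd_symbol \<rho> k \<xi>)"
proof -
  obtain h where h: "h > 0"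
    "\<And>k \<xi>. (\<And>j. \<bar>k $ j\<bar> \<le> pi) \<Longrightarrow> h * (norm k)\<^sup>2 * (norm \<xi>)\<^sup>2 \<le>
         K (even_symbol \<rho> k \<xi>) (even_symbol \<rho> k \<xi>) + K (odd_symbol \<rho> k \<xi>) (odd_symbol \<rho> k \<xi>)"
    using symbol_coercive_box[OF assms] by metis
  define M where "M = (\<Sum>i\<in>UNIV. (norm (real_vec (\<rho> i)))\<^sup>2)"
  have M: "M \<ge> 0" unfolding M_def by (simp add: sum_nonneg)
  show thesis
  \<comment> \<open>The summand 1 keeps the denominator positive knowing only
    \<open>M \<ge> 0\<close>.\<close>
  proof (rule that[of "h / (M + 1)"])
    show "h / (M + 1) > 0" using h(1) M by simp
    fix k \<xi>
    obtain k' :: "real^'d" where k': "\<And>j. \<bar>k' $ j\<bar> \<le> pi"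
      "\<And>z. cos (k' \<bullet> real_vec z) = cos (k \<bullet> real_vec z)"
      "\<And>z. sin (k' \<bullet> real_vec z) = sin (k \<bullet> real_vec z)"
      using exists_box_representative[of k] by metis
    have eq: "even_symbol \<rho> k \<xi> = even_symbol \<rho> k' \<xi>" "odd_symbol \<rho> k \<xi> = odd_symbol \<rho> k' \<xi>"
      by (simp_all add: even_symbol_def odd_symbol_def k')
    have "(norm (even_symbol \<rho> k' \<xi>))\<^sup>2 + (norm (odd_symbol \<rho> k' \<xi>))\<^sup>2
        \<le> M * ((norm k')\<^sup>2 * (norm \<xi>)\<^sup>2)"
      unfolding M_def by (rule norm_symbol_le)
    also have "\<dots> \<le> (M + 1) * ((norm k')\<^sup>2 * (norm \<xi>)\<^sup>2)" by (intro mult_right_mono) auto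
    finally have "h / (M + 1) * ((norm (even_symbol \<rho> k' \<xi>))\<^sup>2 + (norm (odd_symbol \<rho> k' \<xi>))\<^sup>2)
        \<le> h / (M + 1) * ((M + 1) * ((norm k')\<^sup>2 * (norm \<xi>)\<^sup>2))"
      using h(1) M by (intro mult_left_mono) auto
    also have "\<dots> = h * (norm k')\<^sup>2 * (norm \<xi>)\<^sup>2" using M by simp
    also note h(2)[OF k'(1)]
    finally show "h / (M + 1) * ((norm (even_symbol \<rho> k \<xi>))\<^sup>2 + (norm (odd_symbol \<rho> k \<xi>))\<^sup>2)
      \<le> K (even_symbol \<rho> k \<xi>) (even_symbol \<rho> k \<xi>) + K (odd_symbol \<rho> k \<xi>) (odd_symbol \<rho> k \<xi>)"
      unfolding eq .
  qed
qed

section \<open>From symbols to finitely supported lattice functions\<close>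

text \<open>Invariance under \<open>T_sym\<close> makes each mixed term equal to its own negative.
  The amplitudes \<open>\<xi>\<close> and \<open>\<zeta>\<close> may differ because the cosine and
  sine transforms of a gradient mix those of the function.\<close>

lemma form_even_odd_split:
  assumes "inj \<rho>" "uminus ` range \<rho> = range \<rho>" and K: "bounded_bilinear K"
    and T: "\<And>A B. K (T_sym \<rho> A) (T_sym \<rho> B) = (K A B :: real)"
  shows "K (even_symbol \<rho> k \<xi> + odd_symbol \<rho> k \<zeta>) (even_symbol \<rho> k \<xi> + odd_symbol \<rho> k \<zeta>)
    = K (even_symbol \<rho> k \<xi>) (even_symbol \<rho> k \<xi>) + K (odd_symbol \<rho> k \<zeta>) (odd_symbol \<rho> k \<zeta>)"
    (is "K (?E + ?O) _ = _")
proof -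
  interpret K: bounded_bilinear K by fact
  have "K ?E ?O = 0" "K ?O ?E = 0"
    using T[of ?E ?O] T[of ?O ?E] by (simp_all add: T_sym_fixed[OF assms(1,2)] K.minus_left K.minus_right)
  then show ?thesis by (simp add: K.add_left K.add_right)
qed

text \<open>Counterpart of \<open>discrete_gradient\<close> on the unit lattice, with integer
  vectors as arguments.\<close>

definition lattice_gradient :: "('r::finite \<Rightarrow> int^'d) \<Rightarrow> (int^'d \<Rightarrow> real^'d) \<Rightarrow> int^'d \<Rightarrow> (real^'d)^'r" where
  "lattice_gradient \<rho> u z = (\<chi> i. u (z + \<rho> i) - u z)"

text \<open>The transform \<open>c - i s\<close> of \<open>u\<close> is multiplied by
  \<open>exp (i k \<bullet> \<rho>) - 1\<close>. The two identities are the real part and the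
  negative of the imaginary part of that product.\<close>

lemma sum_lattice_gradient:
  fixes u :: "int^'d \<Rightarrow> real^'d" and Z :: "(int^'d) set" and k :: "real^'d"
  assumes Z: "finite Z" "\<And>z. z \<notin> Z \<Longrightarrow> u z = 0" "\<And>z i. z \<notin> Z \<Longrightarrow> u (z + \<rho> i) = 0"
  defines "c \<equiv> \<Sum>z\<in>Z. cos (k \<bullet> real_vec z) *\<^sub>R u z"
    and "s \<equiv> \<Sum>z\<in>Z. sin (k \<bullet> real_vec z) *\<^sub>R u z"
  shows "(\<Sum>z\<in>Z. cos (k \<bullet> real_vec z) *\<^sub>R lattice_gradient \<rho> u z)
      = even_symbol \<rho> k c + odd_symbol \<rho> k s"
    and "(\<Sum>z\<in>Z. sin (k \<bullet> real_vec z) *\<^sub>R lattice_gradient \<rho> u z)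
      = even_symbol \<rho> k s + odd_symbol \<rho> k (- c)"
proof -
  \<comment> \<open>Summation by translation leaves no boundary terms: \<open>z\<close> and
    \<open>z - \<rho> i\<close> both lie in \<open>Z\<close> whenever
    \<open>u z \<noteq> 0\<close>.\<close>
  have shift: "(\<Sum>z\<in>Z. f z *\<^sub>R u (z + \<rho> i)) = (\<Sum>z\<in>Z. f (z - \<rho> i) *\<^sub>R u z)" for f i
    by (rule sum.reindex_bij_witness_not_neutral[of
          "{z \<in> Z. u (z + \<rho> i) = 0}" "{z \<in> Z. u z = 0}" _ "\<lambda>z. z - \<rho> i" "\<lambda>z. z + \<rho> i"])
      (use Z Z(3)[of "z - \<rho> i" i for z] in \<open>auto simp: algebra_simps\<close>)
  have c: "cos (k \<bullet> real_vec (z - \<rho> i)) *\<^sub>R v - cos (k \<bullet> real_vec z) *\<^sub>R v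
      = (cos (k \<bullet> real_vec (\<rho> i)) - 1) *\<^sub>R (cos (k \<bullet> real_vec z) *\<^sub>R v)
      + sin (k \<bullet> real_vec (\<rho> i)) *\<^sub>R (sin (k \<bullet> real_vec z) *\<^sub>R v)" for z i and v :: "real^'d"
    by (simp add: inner_diff_right cos_diff algebra_simps)
  have s: "sin (k \<bullet> real_vec (z - \<rho> i)) *\<^sub>R v - sin (k \<bullet> real_vec z) *\<^sub>R v
      = (cos (k \<bullet> real_vec (\<rho> i)) - 1) *\<^sub>R (sin (k \<bullet> real_vec z) *\<^sub>R v)
      - sin (k \<bullet> real_vec (\<rho> i)) *\<^sub>R (cos (k \<bullet> real_vec z) *\<^sub>R v)" for z i and v :: "real^'d"
    by (simp add: inner_diff_right sin_diff algebra_simps)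
  show "(\<Sum>z\<in>Z. cos (k \<bullet> real_vec z) *\<^sub>R lattice_gradient \<rho> u z)
      = even_symbol \<rho> k c + odd_symbol \<rho> k s"
  proof (rule vec_eq_iff[THEN iffD2], rule allI)
    fix i
    have "(\<Sum>z\<in>Z. cos (k \<bullet> real_vec z) *\<^sub>R lattice_gradient \<rho> u z) $ i
        = (\<Sum>z\<in>Z. cos (k \<bullet> real_vec z) *\<^sub>R u (z + \<rho> i)) - (\<Sum>z\<in>Z. cos (k \<bullet> real_vec z) *\<^sub>R u z)"
      by (simp add: lattice_gradient_def scaleR_diff_right sum_subtractf)
    also have "\<dots> = (\<Sum>z\<in>Z. cos (k \<bullet> real_vec (z - \<rho> i)) *\<^sub>R u z - cos (k \<bullet> real_vec z) *\<^sub>R u z)"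
      unfolding shift by (simp only: sum_subtractf)
    also have "\<dots> = (even_symbol \<rho> k c + odd_symbol \<rho> k s) $ i"
      unfolding c by (simp add: symbol_simps c_def s_def sum.distrib scaleR_sum_right)
    finally show "(\<Sum>z\<in>Z. cos (k \<bullet> real_vec z) *\<^sub>R lattice_gradient \<rho> u z) $ i
      = (even_symbol \<rho> k c + odd_symbol \<rho> k s) $ i" .
  qed
  show "(\<Sum>z\<in>Z. sin (k \<bullet> real_vec z) *\<^sub>R lattice_gradient \<rho> u z)
      = even_symbol \<rho> k s + odd_symbol \<rho> k (- c)"
  proof (rule vec_eq_iff[THEN iffD2], rule allI)
    fix i
    have "(\<Sum>z\<in>Z. sin (k \<bullet> real_vec z) *\<^sub>R lattice_gradient \<rho> u z) $ i
        = (\<Sum>z\<in>Z. sin (k \<bullet> real_vec z) *\<^sub>R u (z + \<rho> i)) - (\<Sum>z\<in>Z. sin (k \<bullet> real_vec z) *\<^sub>R u z)"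
      by (simp add: lattice_gradient_def scaleR_diff_right sum_subtractf)
    also have "\<dots> = (\<Sum>z\<in>Z. sin (k \<bullet> real_vec (z - \<rho> i)) *\<^sub>R u z - sin (k \<bullet> real_vec z) *\<^sub>R u z)"
      unfolding shift by (simp only: sum_subtractf)
    also have "\<dots> = (even_symbol \<rho> k s + odd_symbol \<rho> k (- c)) $ i"
      unfolding s by (simp add: symbol_simps c_def s_def sum_subtractf scaleR_sum_right)
    finally show "(\<Sum>z\<in>Z. sin (k \<bullet> real_vec z) *\<^sub>R lattice_gradient \<rho> u z) $ i
      = (even_symbol \<rho> k s + odd_symbol \<rho> k (- c)) $ i" .
  qed
qed

text \<open>The vanishing conditions place the supports of \<open>u\<close> and of its gradient
  inside \<open>Z\<close>, so the sums are in effect over the whole lattice. The constant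
  \<open>c\<close> is uniform in \<open>u\<close> and \<open>Z\<close>.\<close>

definition gradient_coercive ::
  "('r::finite \<Rightarrow> int^'d) \<Rightarrow> ((real^'d)^'r \<Rightarrow> (real^'d)^'r \<Rightarrow> real) \<Rightarrow> real \<Rightarrow> bool" where
  "gradient_coercive \<rho> K c \<longleftrightarrow>
     (\<forall>u Z. finite Z \<longrightarrow> (\<forall>z. z \<notin> Z \<longrightarrow> u z = 0) \<longrightarrow> (\<forall>z i. z \<notin> Z \<longrightarrow> u (z + \<rho> i) = 0) \<longrightarrow>
       c * (\<Sum>z\<in>Z. (norm (lattice_gradient \<rho> u z))\<^sup>2)
         \<le> (\<Sum>z\<in>Z. K (lattice_gradient \<rho> u z) (lattice_gradient \<rho> u z)))"

text \<open>Parseval's identity is applied both to \<open>K\<close> and to the inner product. Each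
  is invariant under \<open>T_sym\<close>, so both split in the same way and can be compared
  frequency by frequency with \<open>symbol_coercive\<close>.\<close>

lemma lattice_gradient_coercive:
  fixes \<rho> :: "'r::finite \<Rightarrow> int^'d" and K :: "(real^'d)^'r \<Rightarrow> (real^'d)^'r \<Rightarrow> real"
  assumes inj: "inj \<rho>" and sym: "uminus ` range \<rho> = range \<rho>"
    and span: "int_span (range \<rho>) = UNIV"
    and K: "bounded_bilinear K" and psd: "\<And>B. K B B \<ge> 0"
    and rank1: "\<And>\<xi> \<eta>. \<xi> \<noteq> 0 \<Longrightarrow> \<eta> \<noteq> 0 \<Longrightarrow>
           K (affine_deformation \<rho> (rank_one \<xi> \<eta>)) (affine_deformation \<rho> (rank_one \<xi> \<eta>)) > 0"
    and orth: "\<And>B. B \<noteq> 0 \<Longrightarrow> (\<And>F. orthogonal B (affine_deformation \<rho> F)) \<Longrightarrow> K B B > 0"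
    and T: "\<And>A B. K (T_sym \<rho> A) (T_sym \<rho> B) = K A B"
  obtains c where "c > 0" "gradient_coercive \<rho> K c"
proof -
  let ?E = "even_symbol \<rho>" and ?O = "odd_symbol \<rho>"
  obtain c where c: "c > 0" "\<And>k \<xi>. c * ((norm (?E k \<xi>))\<^sup>2 + (norm (?O k \<xi>))\<^sup>2)
      \<le> K (?E k \<xi>) (?E k \<xi>) + K (?O k \<xi>) (?O k \<xi>)"
    using symbol_coercive[OF inj sym span K psd rank1 orth] by blast
  have neg: "B (?O k (- \<xi>)) (?O k (- \<xi>)) = B (?O k \<xi>) (?O k \<xi>)"
    if "bounded_bilinear B" for B :: "(real^'d)^'r \<Rightarrow> (real^'d)^'r \<Rightarrow> real" and k \<xi>
    using symbol_scaleR(2)[of \<rho> k "-1" \<xi>] bounded_bilinear.minus_left[OF that]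
      bounded_bilinear.minus_right[OF that] by simp
  show thesis
  proof (rule that[OF c(1)], unfold gradient_coercive_def, intro allI impI)
    fix u :: "int^'d \<Rightarrow> real^'d" and Z :: "(int^'d) set"
    assume fin: "finite Z" and supp: "\<forall>z. z \<notin> Z \<longrightarrow> u z = 0" "\<forall>z i. z \<notin> Z \<longrightarrow> u (z + \<rho> i) = 0"
    note Z = fin supp[rule_format]
    let ?D = "lattice_gradient \<rho> u"
    obtain ks :: "nat \<Rightarrow> real^'d" and N :: nat where N: "N > 0"
      and Parseval: "\<And>(B :: (real^'d)^'r \<Rightarrow> (real^'d)^'r \<Rightarrow> real) g. bounded_bilinear B \<Longrightarrow>
      (\<Sum>m<N. B (\<Sum>z\<in>Z. cos (ks m \<bullet> real_vec z) *\<^sub>R g z) (\<Sum>z\<in>Z. cos (ks m \<bullet> real_vec z) *\<^sub>R g z)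
           + B (\<Sum>z\<in>Z. sin (ks m \<bullet> real_vec z) *\<^sub>R g z) (\<Sum>z\<in>Z. sin (ks m \<bullet> real_vec z) *\<^sub>R g z))
      = real N * (\<Sum>z\<in>Z. B (g z) (g z))"
      by (rule discrete_Parseval[OF Z(1), where 'v = "(real^'d)^'r"]) (rule that)
    define p where "p m = (\<Sum>z\<in>Z. cos (ks m \<bullet> real_vec z) *\<^sub>R u z)" for m
    define q where "q m = (\<Sum>z\<in>Z. sin (ks m \<bullet> real_vec z) *\<^sub>R u z)" for m
    have cos_D: "(\<Sum>z\<in>Z. cos (ks m \<bullet> real_vec z) *\<^sub>R ?D z) = ?E (ks m) (p m) + ?O (ks m) (q m)" for m
      unfolding p_def q_def by (rule sum_lattice_gradient(1)[of Z u \<rho>, OF Z])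
    have sin_D: "(\<Sum>z\<in>Z. sin (ks m \<bullet> real_vec z) *\<^sub>R ?D z) = ?E (ks m) (q m) + ?O (ks m) (- p m)" for m
      unfolding p_def q_def by (rule sum_lattice_gradient(2)[of Z u \<rho>, OF Z])
    \<comment> \<open>The cosine part yields even \<open>p\<close> and odd \<open>q\<close>, the
      sine part even \<open>q\<close> and odd \<open>- p\<close>. Regrouping pairs even and odd
      terms of equal amplitude, as the symbol estimate requires.\<close>
    have transform: "real N * (\<Sum>z\<in>Z. B (?D z) (?D z)) =
        (\<Sum>m<N. (B (?E (ks m) (p m)) (?E (ks m) (p m)) + B (?O (ks m) (p m)) (?O (ks m) (p m)))
             + (B (?E (ks m) (q m)) (?E (ks m) (q m)) + B (?O (ks m) (q m)) (?O (ks m) (q m))))"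
      if B: "bounded_bilinear B" and BT: "\<And>A A'. B (T_sym \<rho> A) (T_sym \<rho> A') = B A A'"
      for B :: "(real^'d)^'r \<Rightarrow> (real^'d)^'r \<Rightarrow> real"
      unfolding Parseval[OF B, symmetric] cos_D sin_D
        form_even_odd_split[OF inj sym B BT] neg[OF B]
      by (simp add: add_ac)
    have "real N * (c * (\<Sum>z\<in>Z. (norm (?D z))\<^sup>2)) = c * (real N * (\<Sum>z\<in>Z. ?D z \<bullet> ?D z))"
      by (simp add: power2_norm_eq_inner)
    also have "\<dots> \<le> real N * (\<Sum>z\<in>Z. K (?D z) (?D z))"
      unfolding transform[OF K T] transform[OF bounded_bilinear_inner T_sym_isometry[OF inj sym]]
      unfolding sum_distrib_left
      by (rule sum_mono) (use add_mono[OF c(2) c(2)] in \<open>simp add: power2_norm_eq_inner distrib_left\<close>)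
    finally show "c * (\<Sum>z\<in>Z. (norm (?D z))\<^sup>2) \<le> (\<Sum>z\<in>Z. K (?D z) (?D z))"
      using N by simp
  qed
qed

section \<open>Second derivatives at a symmetric local minimizer\<close>

text \<open>Along the line through \<open>a\<close> in direction \<open>v\<close> the first
  derivative vanishes at 0. A negative second derivative would make it negative just to the right,
  so \<open>f\<close> would drop below \<open>f a\<close>.\<close>

lemma second_derivative_nonneg_at_local_min:
  fixes f :: "'a::real_normed_vector \<Rightarrow> real"
  assumes U: "open U" "a \<in> U"
    and f': "\<And>x. x \<in> U \<Longrightarrow> (f has_derivative blinfun_apply (f' x)) (at x)"
    and f'': "(f' has_derivative blinfun_apply f'') (at a)"
    and min: "eventually (\<lambda>x. f a \<le> f x) (nhds a)"
  shows "blinfun_apply (blinfun_apply f'' v) v \<ge> 0"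
proof (rule ccontr)
  assume neg: "\<not> ?thesis"
  obtain V where V: "open V" "a \<in> V" "\<And>x. x \<in> V \<Longrightarrow> f a \<le> f x"
    using min unfolding eventually_nhds by blast
  define l where "l t = a + t *\<^sub>R v" for t
  have l: "(l has_derivative (\<lambda>h. h *\<^sub>R v)) (at t)" for t
    unfolding l_def by (auto intro!: derivative_eq_intros)
  have g: "((\<lambda>t. f (l t)) has_real_derivative blinfun_apply (f' (l t)) v) (at t)" if "l t \<in> U" for t
    using has_derivative_compose[OF l f'[OF that]]
    by (simp add: has_field_derivative_def blinfun.scaleR_right mult_commute_abs)
  have "((\<lambda>t. blinfun_apply (f' (l t)) v) has_derivative (\<lambda>h. blinfun_apply (blinfun_apply f'' (h *\<^sub>R v)) v)) (at 0)"
    by (rule bounded_linear.has_derivative[OF blinfun.bounded_linear_left])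
      (rule has_derivative_compose[OF l], simp add: l_def f'')
  then have g': "((\<lambda>t. blinfun_apply (f' (l t)) v) has_real_derivative blinfun_apply (blinfun_apply f'' v) v) (at 0)"
    by (simp add: has_field_derivative_def blinfun.scaleR_left blinfun.scaleR_right mult_commute_abs)
  have "open (l -` (U \<inter> V))"
    using U(1) V(1) unfolding l_def by (intro open_vimage open_Int continuous_intros) auto
  moreover have "0 \<in> l -` (U \<inter> V)" using U V by (simp add: l_def)
  ultimately obtain e where e: "e > 0" "\<And>t. \<bar>t\<bar> < e \<Longrightarrow> l t \<in> U \<inter> V"
    unfolding open_dist by (force simp: dist_real_def)
  have "blinfun_apply (f' (l 0)) v = 0"
  proof (rule DERIV_local_min[OF g e(1)])
    show "l 0 \<in> U" using e by auto
    show "\<forall>t. \<bar>0 - t\<bar> < e \<longrightarrow> f (l 0) \<le> f (l t)" using e(2) V(3) by (auto simp: l_def)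
  qed
  with DERIV_neg_dec_right[OF g'] neg obtain d where d: "d > 0"
    "\<And>h. 0 < h \<Longrightarrow> h < d \<Longrightarrow> blinfun_apply (f' (l h)) v < 0" by auto
  define h where "h = min d e / 2"
  have h: "0 < h" "h < d" "h < e" using d(1) e(1) by (auto simp: h_def)
  have "f (l h) < f (l 0)"
  proof (rule DERIV_neg_imp_decreasing_open[OF h(1)])
    fix t assume "0 < t" "t < h"
    then show "\<exists>y. ((\<lambda>t. f (l t)) has_real_derivative y) (at t) \<and> y < 0"
      using g[of t] d(2)[of t] e(2)[of t] h by auto
  next
    show "continuous_on {0..h} (\<lambda>t. f (l t))"
      by (rule continuous_at_imp_continuous_on) (use e(2) h in \<open>auto intro!: DERIV_isCont[OF g]\<close>)
  qed
  moreover have "f (l 0) \<le> f (l h)" using V(3)[of "l h"] e(2)[of h] h by (auto simp: l_def)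
  ultimately show False by simp
qed

text \<open>Differentiate the identity \<open>f (T x) = f x\<close> twice at the fixed point
  \<open>a\<close> and use uniqueness of derivatives.\<close>

lemma second_derivative_invariant:
  fixes f :: "'a::real_normed_vector \<Rightarrow> real" and T :: "'a \<Rightarrow> 'a"
  assumes U: "open U" "a \<in> U"
    and f': "\<And>x. x \<in> U \<Longrightarrow> (f has_derivative blinfun_apply (f' x)) (at x)"
    and f'': "(f' has_derivative blinfun_apply f'') (at a)"
    and T: "bounded_linear T" "T a = a" and inv: "\<And>x. f (T x) = f x"
  shows "blinfun_apply (blinfun_apply f'' (T u)) (T v) = blinfun_apply (blinfun_apply f'' u) v"
proof -
  have dT: "(T has_derivative T) (at x)" for x
    by (rule bounded_linear.has_derivative[OF T(1) has_derivative_ident])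
  \<comment> \<open>The chain rule needs differentiability at both \<open>x\<close> and
    \<open>T x\<close>.\<close>
  define V where "V = U \<inter> T -` U"
  have V: "open V" "a \<in> V"
    unfolding V_def using U T(2)
    by (auto intro!: open_Int open_vimage bounded_linear.continuous_on[OF T(1)] continuous_on_id)
  have eq: "blinfun_apply (f' (T x)) (T v) = blinfun_apply (f' x) v" if "x \<in> V" for x
  proof -
    have "(f has_derivative (\<lambda>h. blinfun_apply (f' (T x)) (T h))) (at x)"
      using has_derivative_compose[OF dT f'[of "T x"]] that by (simp add: V_def inv)
    moreover have "(f has_derivative blinfun_apply (f' x)) (at x)" using f' that by (simp add: V_def)
    ultimately show ?thesis using has_derivative_unique by metis
  qed
  have "((\<lambda>x. blinfun_apply (f' (T x)) (T v)) has_derivative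
      (\<lambda>h. blinfun_apply (blinfun_apply f'' (T h)) (T v))) (at a)"
    by (rule bounded_linear.has_derivative[OF blinfun.bounded_linear_left])
      (rule has_derivative_compose[OF dT], simp add: T(2) f'')
  then have "((\<lambda>x. blinfun_apply (f' x) v) has_derivative
      (\<lambda>h. blinfun_apply (blinfun_apply f'' (T h)) (T v))) (at a)"
    by (rule has_derivative_transform_within_open[OF _ V]) (rule eq)
  moreover have "((\<lambda>x. blinfun_apply (f' x) v) has_derivative
      (\<lambda>h. blinfun_apply (blinfun_apply f'' h) v)) (at a)"
    by (rule bounded_linear.has_derivative[OF blinfun.bounded_linear_left f''])
  ultimately show ?thesis using has_derivative_unique by metis
qed

section \<open>Reduction of the scaled problem on a domain to the unit lattice\<close>

lemma finite_bounded_lattice: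
  fixes S :: "(real^'d) set"
  assumes "\<epsilon> > 0" "bounded S"
  shows "finite (S \<inter> lattice \<epsilon>)"
proof -
  obtain b where b: "\<And>x. x \<in> S \<Longrightarrow> norm x \<le> b" using assms(2) bounded_iff by blast
  define n where "n = \<lceil>b / \<epsilon>\<rceil>"
  have "S \<inter> lattice \<epsilon> \<subseteq> (\<lambda>f. \<epsilon> *\<^sub>R real_vec (\<chi> j. f j)) ` (PiE UNIV (\<lambda>_. {-n..n}))"
  proof
    fix x assume x: "x \<in> S \<inter> lattice \<epsilon>"
    then obtain z where z: "x = \<epsilon> *\<^sub>R real_vec z" by (auto simp: lattice_def)
    have "z $ j \<in> {-n..n}" for j
    proof -
      have "\<epsilon> * \<bar>real_of_int (z $ j)\<bar> = \<bar>x $ j\<bar>"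
        using assms(1) by (simp add: z real_vec_def abs_mult)
      also have "\<dots> \<le> b" using component_le_norm_cart[of x j] b[of x] x by simp
      finally have "\<epsilon> * \<bar>real_of_int (z $ j)\<bar> \<le> b" .
      then have "\<bar>real_of_int (z $ j)\<bar> \<le> b / \<epsilon>" using assms(1) by (simp add: field_simps)
      then have "\<bar>real_of_int (z $ j)\<bar> \<le> real_of_int n" unfolding n_def by linarith
      then show ?thesis by auto
    qed
    then show "x \<in> (\<lambda>f. \<epsilon> *\<^sub>R real_vec (\<chi> j. f j)) ` (PiE UNIV (\<lambda>_. {-n..n}))"
      unfolding z by (intro image_eqI[of _ _ "\<lambda>j. z $ j"]) auto
  qed
  moreover have "finite (PiE (UNIV :: 'd set) (\<lambda>_. {-n..n}))" by (intro finite_PiE) auto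
  ultimately show ?thesis using finite_surj by blast
qed

lemma norm_le_R0: "norm (real_vec (\<rho> i)) \<le> R0 \<rho>"
  unfolding R0_def by (intro max.coboundedI1 Max_ge) auto

text \<open>The factor 2 in \<open>admissible0\<close> leaves room for one shift of length
  \<open>\<epsilon> * R0 \<rho>\<close>. Such a shift cannot leave \<open>\<Omega>\<close>, since
  the segment would meet the frontier too close to \<open>x\<close>.\<close>

lemma near_support_in_sint:
  fixes y :: "real^'d \<Rightarrow> real^'d"
  assumes \<epsilon>: "\<epsilon> > 0" and y: "y \<in> admissible0 \<rho> \<epsilon> \<Omega>" "y x \<noteq> 0"
    and x': "x' \<in> lattice \<epsilon>" "dist x x' \<le> \<epsilon> * R0 \<rho>"
  shows "x' \<in> sint \<rho> \<epsilon> \<Omega>"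
proof -
  have x: "x \<in> \<Omega>" "infdist x (frontier \<Omega>) > 2 * \<epsilon> * R0 \<rho>"
    using y by (auto simp: admissible0_def not_le)
  have "infdist x' (frontier \<Omega>) > \<epsilon> * R0 \<rho>"
    using infdist_triangle[of x "frontier \<Omega>" x'] x(2) x'(2) by linarith
  moreover have "x' \<in> \<Omega>"
  proof (rule ccontr)
    assume "x' \<notin> \<Omega>"
    then have "closed_segment x x' \<inter> frontier \<Omega> \<noteq> {}"
      using x(1) by (intro connected_Int_frontier) auto
    then obtain p where p: "p \<in> closed_segment x x'" "p \<in> frontier \<Omega>" by blast
    have "infdist x (frontier \<Omega>) \<le> dist x p" using p(2) by (rule infdist_le)
    also have "\<dots> \<le> dist x x'" using segment_bound(1)[OF p(1)] by (simp add: dist_norm norm_minus_commute)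
    finally show False using x' x(2) zero_le_dist[of x x'] by linarith
  qed
  ultimately show ?thesis using x'(1) by (simp add: sint_def)
qed

text \<open>A function with zero gradient is periodic in direction \<open>\<rho> i\<close>, so one
  nonzero value would give infinitely many.\<close>

lemma lattice_gradient_nonzero:
  fixes u :: "int^'d \<Rightarrow> real^'d"
  assumes fin: "finite {z. u z \<noteq> 0}" and u: "u z \<noteq> 0" and \<rho>: "\<rho> i \<noteq> 0"
  obtains z' where "lattice_gradient \<rho> u z' \<noteq> 0"
proof (rule ccontr)
  assume "\<not> thesis"
  then have 0: "lattice_gradient \<rho> u z' = 0" for z' using that by blast
  have step: "u (z' + \<rho> i) = u z'" for z'
    using arg_cong[OF 0[of z'], of "\<lambda>v. v $ i"] by (simp add: lattice_gradient_def)
  have "u (z + of_nat n *s \<rho> i) = u z" for n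
  proof (induction n)
    case (Suc n)
    have "z + of_nat (Suc n) *s \<rho> i = (z + of_nat n *s \<rho> i) + \<rho> i"
      by (simp add: vec_eq_iff algebra_simps)
    then show ?case using step Suc by metis
  qed simp
  then have "range (\<lambda>n. z + of_nat n *s \<rho> i) \<subseteq> {z. u z \<noteq> 0}" using u by auto
  then have "finite (range (\<lambda>n::nat. z + of_nat n *s \<rho> i))" using fin finite_subset by blast
  moreover have "inj (\<lambda>n::nat. z + of_nat n *s \<rho> i)"
    using \<rho> by (auto simp: inj_def vec_eq_iff)
  ultimately show False using finite_imageD infinite_UNIV_nat by blast
qed

text \<open>The rescaling \<open>u z = y (\<epsilon> z) / \<epsilon>\<close> preserves gradients and
  removes \<open>\<epsilon>\<close>, so \<open>c\<close> does not depend on it. Boundary room from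
  \<open>near_support_in_sint\<close> gives the support conditions.\<close>

lemma discrete_gradient_coercive:
  fixes \<rho> :: "'r::finite \<Rightarrow> int^'d" and K :: "(real^'d)^'r \<Rightarrow> (real^'d)^'r \<Rightarrow> real"
  assumes coercive: "gradient_coercive \<rho> K c"
    and \<rho>: "0 \<notin> range \<rho>" and "bounded \<Omega>"
    and \<epsilon>: "\<epsilon> > 0" and y: "y \<in> admissible0 \<rho> \<epsilon> \<Omega>" "y \<noteq> (\<lambda>_. 0)"
  shows "c \<le> (\<Sum>x\<in>sint \<rho> \<epsilon> \<Omega>. K (discrete_gradient \<rho> \<epsilon> y x) (discrete_gradient \<rho> \<epsilon> y x)) /
      (\<Sum>x\<in>sint \<rho> \<epsilon> \<Omega>. (norm (discrete_gradient \<rho> \<epsilon> y x))\<^sup>2)"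
proof -
  let ?x = "\<lambda>z. \<epsilon> *\<^sub>R real_vec z"
  define Z where "Z = {z. ?x z \<in> sint \<rho> \<epsilon> \<Omega>}"
  define u where "u z = y (?x z) /\<^sub>R \<epsilon>" for z
  have inj: "inj ?x" using \<epsilon> by (auto simp: inj_def)
  have sint: "sint \<rho> \<epsilon> \<Omega> = ?x ` Z" unfolding Z_def by (auto simp: sint_def lattice_def)
  have "sint \<rho> \<epsilon> \<Omega> \<subseteq> \<Omega> \<inter> lattice \<epsilon>" by (auto simp: sint_def)
  then have "finite (sint \<rho> \<epsilon> \<Omega>)" using finite_bounded_lattice[OF \<epsilon> \<open>bounded \<Omega>\<close>] finite_subset by blast
  then have Z: "finite Z" using sint inj by (metis finite_imageD inj_on_subset subset_UNIV)
  have R0: "R0 \<rho> \<ge> 0" using norm_le_R0[of \<rho> undefined] norm_ge_zero order_trans by blast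
  have Z0: "u z = 0" if "z \<notin> Z" for z
  proof (rule ccontr)
    assume "u z \<noteq> 0"
    then have "?x z \<in> sint \<rho> \<epsilon> \<Omega>"
      using R0 \<epsilon> by (intro near_support_in_sint[OF \<epsilon> y(1), of "?x z"]) (auto simp: u_def lattice_def)
    then show False using that by (simp add: Z_def)
  qed
  have Z1: "u (z + \<rho> i) = 0" if "z \<notin> Z" for z i
  proof (rule ccontr)
    assume "u (z + \<rho> i) \<noteq> 0"
    then have "?x z \<in> sint \<rho> \<epsilon> \<Omega>"
      using norm_le_R0[of \<rho> i] \<epsilon>
      by (intro near_support_in_sint[OF \<epsilon> y(1), of "?x (z + \<rho> i)"])
        (auto simp: u_def lattice_def dist_norm scaleR_diff_right[symmetric] simp del: scaleR_add_right)
    then show False using that by (simp add: Z_def)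
  qed
  have grad: "discrete_gradient \<rho> \<epsilon> y (?x z) = lattice_gradient \<rho> u z" for z
    by (simp add: vec_eq_iff discrete_gradient_def lattice_gradient_def u_def scaleR_add_right
        right_diff_distrib)
  have sums: "(\<Sum>x\<in>sint \<rho> \<epsilon> \<Omega>. g (discrete_gradient \<rho> \<epsilon> y x)) = (\<Sum>z\<in>Z. g (lattice_gradient \<rho> u z))"
    for g :: "(real^'d)^'r \<Rightarrow> real"
    unfolding sint by (subst sum.reindex) (use inj in \<open>auto simp: grad intro: inj_on_subset\<close>)
  \<comment> \<open>The denominator must be shown positive, since a quotient by zero evaluates to 0.
    The index \<open>undefined\<close> below stands for an arbitrary interaction vector.\<close>
  obtain x where "y x \<noteq> 0" using y(2) by auto
  moreover then obtain z where "x = ?x z" using y(1) by (auto simp: admissible0_def lattice_def)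
  ultimately have uz: "u z \<noteq> 0" using \<epsilon> by (simp add: u_def)
  have "{z. u z \<noteq> 0} \<subseteq> Z" using Z0 by auto
  then have "finite {z. u z \<noteq> 0}" using Z finite_subset by blast
  moreover have "\<rho> undefined \<noteq> 0" using \<rho> by (metis rangeI)
  ultimately obtain z' where z': "lattice_gradient \<rho> u z' \<noteq> 0"
    using lattice_gradient_nonzero[of u z \<rho> undefined] uz by metis
  have "z' \<in> Z"
  proof (rule ccontr)
    assume "z' \<notin> Z"
    then have "lattice_gradient \<rho> u z' $ i = 0" for i by (simp add: lattice_gradient_def Z0 Z1)
    with z' show False by (simp add: vec_eq_iff[of _ 0])
  qed
  then have "(\<Sum>z\<in>Z. (norm (lattice_gradient \<rho> u z))\<^sup>2) > 0"
    using z' Z by (intro sum_pos2[of _ z']) auto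
  moreover have "c * (\<Sum>z\<in>Z. (norm (lattice_gradient \<rho> u z))\<^sup>2)
         \<le> (\<Sum>z\<in>Z. K (lattice_gradient \<rho> u z) (lattice_gradient \<rho> u z))"
    using coercive Z Z0 Z1 unfolding gradient_coercive_def by simp
  ultimately show ?thesis
    unfolding sums[of "\<lambda>v. K v v"] sums[of "\<lambda>v. (norm v)\<^sup>2"] by (simp add: pos_le_divide_eq)
qed

section \<open>Positivity of the atomistic stability constant\<close>

theorem proposition3p10:
  fixes \<rho> :: "'r::finite \<Rightarrow> int^'d"
    and W :: "(real^'d)^'r \<Rightarrow> ereal"
    and A0 :: "real^'d^'d"
    and \<Omega> :: "(real^'d) set"
  assumes "inj \<rho>"
    and "0 \<notin> range \<rho>"
    and "int_span (range \<rho>) = UNIV"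
    and "uminus ` range \<rho> = range \<rho>"
    and "open \<Omega>" and "bounded \<Omega>" and "\<Omega> \<noteq> {}"
    and "\<And>A. W A \<noteq> -\<infinity>"
    and "C2_near W (affine_deformation \<rho> A0)"
    and "\<And>A. W A = W (T_sym \<rho> A)"
    and "eventually (\<lambda>A. W (affine_deformation \<rho> A0) \<le> W A) (nhds (affine_deformation \<rho> A0))"
    and "\<And>\<xi> \<eta>. \<xi> \<noteq> 0 \<Longrightarrow> \<eta> \<noteq> 0 \<Longrightarrow>
           D2W \<rho> W A0 (affine_deformation \<rho> (rank_one \<xi> \<eta>)) (affine_deformation \<rho> (rank_one \<xi> \<eta>)) > 0"
    and "\<And>B. B \<noteq> 0 \<Longrightarrow> (\<And>F. orthogonal B (affine_deformation \<rho> F)) \<Longrightarrow> D2W \<rho> W A0 B B > 0"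
  shows "lambda_atom \<rho> \<Omega> W A0 > 0"
proof -
  define a where "a = affine_deformation \<rho> A0"
  define f where "f x = real_of_ereal (W x)" for x
  let ?K = "D2W \<rho> W A0"
  obtain U where U: "open U" "a \<in> U" "\<And>x. x \<in> U \<Longrightarrow> \<bar>W x\<bar> \<noteq> \<infinity>" and "C2_on f U"
    using assms(9) unfolding C2_near_def a_def[symmetric] f_def[symmetric, abs_def] by auto
  then obtain f' f'' where C2: "\<forall>x\<in>U. (f has_derivative blinfun_apply (f' x)) (at x)"
      "\<forall>x\<in>U. (f' has_derivative blinfun_apply (f'' x)) (at x)"
    unfolding C2_on_def by auto
  note f' = C2(1)[rule_format] and f'' = C2(2)[rule_format]
  have K_eq: "?K u v = blinfun_apply (blinfun_apply (f'' a) u) v" for u v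
    unfolding D2W_def a_def[symmetric] f_def[symmetric, abs_def]
    by (rule D2_eq[OF U(1,2) f' f''[OF U(2)]])
  have "bounded_bilinear (\<lambda>u v. blinfun_apply (blinfun_apply (f'' a) u) v)"
    by (intro bounded_bilinear.comp1[OF bounded_bilinear_blinfun_apply] blinfun.bounded_linear_right)
  then have K: "bounded_bilinear ?K" by (simp add: K_eq[abs_def])
  have "eventually (\<lambda>x. x \<in> U) (nhds a)" using U by (simp add: eventually_nhds_in_open)
  moreover have "eventually (\<lambda>x. W a \<le> W x) (nhds a)" using assms(11) by (simp add: a_def)
  \<comment> \<open>On \<open>U\<close> the values of \<open>W\<close> are finite, so the order of
    extended reals passes to the real-valued \<open>f\<close>.\<close>
  ultimately have min: "eventually (\<lambda>x. f a \<le> f x) (nhds a)"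
  proof eventually_elim
    case (elim x)
    then show ?case using U(3)[of x] U(3)[OF U(2)] unfolding f_def by (cases "W x"; cases "W a") auto
  qed
  have psd: "?K B B \<ge> 0" for B
    unfolding K_eq by (rule second_derivative_nonneg_at_local_min[OF U(1,2) f' f''[OF U(2)] min])
  have T: "?K (T_sym \<rho> A) (T_sym \<rho> B) = ?K A B" for A B
    unfolding K_eq
    by (rule second_derivative_invariant[OF U(1,2) f' f''[OF U(2)] bounded_linear_T_sym])
      (simp_all add: a_def T_sym_fixed[OF assms(1,4)] f_def assms(10)[symmetric])
  obtain c where c: "c > 0" "gradient_coercive \<rho> ?K c"
  proof (rule lattice_gradient_coercive[OF assms(1,4,3) K psd])
    show "?K (affine_deformation \<rho> (rank_one \<xi> \<eta>)) (affine_deformation \<rho> (rank_one \<xi> \<eta>)) > 0"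
      if "\<xi> \<noteq> 0" "\<eta> \<noteq> 0" for \<xi> \<eta>
      using that by (rule assms(12))
    show "?K B B > 0" if "B \<noteq> 0" "\<And>F. orthogonal B (affine_deformation \<rho> F)" for B
      using that by (rule assms(13))
  qed (rule T, rule that)
  \<comment> \<open>The bound \<open>c\<close> is uniform in \<open>\<epsilon>\<close> and
    \<open>y\<close>, hence survives both infima; where no nonzero admissible \<open>y\<close>
    exists, the inner infimum is infinite.\<close>
  have "ereal c \<le> lambda_atom \<rho> \<Omega> W A0"
    unfolding lambda_atom_def lambda_atom_form_def
    by (intro INF_greatest) (auto intro!: discrete_gradient_coercive[OF c(2) assms(2,6)])
  moreover have "0 < ereal c" using c(1) by simp
  ultimately show ?thesis by (rule less_le_trans[rotated])
qed

end
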